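(* Let $\Sigma=\{\sigma_1,\ldots,\sigma_n\}$ be a collection of maps $\{1,\ldots,N\}\to\{1,\ldots,N\}$, not necessarily forming a semigroup, and let $p:\{1,\ldots,N\}\to\{1,\ldots,N\}$ be a permutation. Then $p$ is a network symmetry for $\Sigma$ if and only if it is a network symmetry for the semigroup $\Sigma'$ generated by $\Sigma$.
   Context: A permutation $p$ of $\{1,\ldots,N\}$ is a network symmetry for a collection of maps on $\{1,\ldots,N\}$ if $p\circ\sigma=\sigma\circ p$ for every map $\sigma$ in the collection. The semigroup $\Sigma'$ generated by $\Sigma$ is the smallest collection of maps $\{1,\ldots,N\}\to\{1,\ldots,N\}$ that contains $\Sigma$ and is closed under composition. *)

theory Defs
  imports "HOL.Hull" "HOL-Combinatorics.Permutations" "HOL-Library.FuncSet"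
begin

text \<open>
  A map from \<open>{1..N}\<close> to \<open>{1..N}\<close> is a function on \<open>nat\<close> that sends \<open>{1..N}\<close> into itself and is
  \<open>undefined\<close> elsewhere, so that HOL equality of such functions is equality of maps on \<open>{1..N}\<close>.
\<close>

abbreviation self_maps :: "nat \<Rightarrow> (nat \<Rightarrow> nat) set" where
  "self_maps N \<equiv> {1..N} \<rightarrow>\<^sub>E {1..N}"

definition map_semigroup :: "nat \<Rightarrow> (nat \<Rightarrow> nat) set \<Rightarrow> bool" where
  "map_semigroup N T \<longleftrightarrow>
     T \<subseteq> self_maps N \<and> (\<forall>\<sigma>\<in>T. \<forall>\<tau>\<in>T. compose {1..N} \<sigma> \<tau> \<in> T)"

text \<open>
  The hull is the intersection of all map semigroups containing \<open>S\<close>; for \<open>S \<subseteq> self_maps N\<close> this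
  family contains \<open>self_maps N\<close>. The identity map need not belong to the result.
\<close>

definition generated_semigroup :: "nat \<Rightarrow> (nat \<Rightarrow> nat) set \<Rightarrow> (nat \<Rightarrow> nat) set" where
  "generated_semigroup N S = map_semigroup N hull S"

text \<open>
  The constant \<open>permutes\<close> makes \<open>p\<close> the identity outside \<open>{1..N}\<close>; \<open>compose\<close> restricts both
  composites to \<open>{1..N}\<close>, so the equation compares them as maps on \<open>{1..N}\<close> only.
\<close>

definition network_symmetry :: "nat \<Rightarrow> (nat \<Rightarrow> nat) set \<Rightarrow> (nat \<Rightarrow> nat) \<Rightarrow> bool" where
  "network_symmetry N S p \<longleftrightarrow>
     p permutes {1..N} \<and> (\<forall>\<sigma>\<in>S. compose {1..N} p \<sigma> = compose {1..N} \<sigma> p)"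

end

theory Submission
  imports Defs
begin

text \<open>
  The maps commuting with \<open>p\<close> form a semigroup, the centralizer of \<open>p\<close>. If \<open>p\<close> is a symmetry for
  \<open>\<Sigma>\<close>, this semigroup contains \<open>\<Sigma>\<close>, hence by minimality of the hull it contains everything that
  \<open>\<Sigma>\<close> generates (\<open>map_semigroup_centralizer\<close>). The converse holds because \<open>\<Sigma>\<close> is contained in the
  semigroup that it generates.
\<close>

definition centralizer :: "nat \<Rightarrow> (nat \<Rightarrow> nat) \<Rightarrow> (nat \<Rightarrow> nat) set" where
  "centralizer N p = {\<tau> \<in> self_maps N. compose {1..N} p \<tau> = compose {1..N} \<tau> p}"

text \<open>
  Moving \<open>p\<close> past one factor at a time gives
  \<open>p \<circ> (\<sigma> \<circ> \<tau>) = \<sigma> \<circ> p \<circ> \<tau> = (\<sigma> \<circ> \<tau>) \<circ> p\<close>. Since the composites are restricted to \<open>{1..N}\<close>,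
  reassociating them requires the innermost map to preserve \<open>{1..N}\<close>; this is where the
  assumption on \<open>p\<close> enters.
\<close>

lemma map_semigroup_centralizer:
  assumes p: "p \<in> {1..N} \<rightarrow> {1..N}"
  shows "map_semigroup N (centralizer N p)"
  unfolding map_semigroup_def
proof (intro conjI ballI)
  show "centralizer N p \<subseteq> self_maps N"
    by (auto simp: centralizer_def)
next
  let ?A = "{1..N}"
  fix \<sigma> \<tau>
  assume "\<sigma> \<in> centralizer N p" and "\<tau> \<in> centralizer N p"
  then have \<sigma>: "\<sigma> \<in> ?A \<rightarrow> ?A" "compose ?A p \<sigma> = compose ?A \<sigma> p"
    and \<tau>: "\<tau> \<in> ?A \<rightarrow> ?A" "compose ?A p \<tau> = compose ?A \<tau> p"
    by (auto simp: centralizer_def)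
  have "compose ?A p (compose ?A \<sigma> \<tau>) = compose ?A (compose ?A p \<sigma>) \<tau>"
    by (rule compose_assoc[OF \<tau>(1)])
  also have "\<dots> = compose ?A (compose ?A \<sigma> p) \<tau>"
    by (simp only: \<sigma>(2))
  also have "\<dots> = compose ?A \<sigma> (compose ?A p \<tau>)"
    by (rule compose_assoc[OF \<tau>(1), symmetric])
  also have "\<dots> = compose ?A \<sigma> (compose ?A \<tau> p)"
    by (simp only: \<tau>(2))
  also have "\<dots> = compose ?A (compose ?A \<sigma> \<tau>) p"
    by (rule compose_assoc[OF p])
  finally have "compose ?A p (compose ?A \<sigma> \<tau>) = compose ?A (compose ?A \<sigma> \<tau>) p" .
  moreover have "compose ?A \<sigma> \<tau> \<in> self_maps N"
    using funcset_compose[OF \<tau>(1) \<sigma>(1)] by (simp add: PiE_def)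
  ultimately show "compose ?A \<sigma> \<tau> \<in> centralizer N p"
    by (simp add: centralizer_def)
qed

theorem lemma7p1:
  fixes N n :: nat and \<sigma> :: "nat \<Rightarrow> nat \<Rightarrow> nat" and \<Sigma> :: "(nat \<Rightarrow> nat) set"
    and p :: "nat \<Rightarrow> nat"
  assumes "\<And>j. j \<in> {1..n} \<Longrightarrow> \<sigma> j \<in> {1..N} \<rightarrow>\<^sub>E {1..N}"
    and "\<Sigma> = \<sigma> ` {1..n}"
    and "p permutes {1..N}"
  shows "network_symmetry N \<Sigma> p \<longleftrightarrow> network_symmetry N (generated_semigroup N \<Sigma>) p"
proof
  assume sym: "network_symmetry N \<Sigma> p"
  have "\<Sigma> \<subseteq> self_maps N"
    using assms(1,2) by blast
  then have "\<Sigma> \<subseteq> centralizer N p"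
    using sym by (auto simp: network_symmetry_def centralizer_def)
  moreover have "p \<in> {1..N} \<rightarrow> {1..N}"
    using permutes_in_image[OF assms(3)] by blast
  ultimately have "generated_semigroup N \<Sigma> \<subseteq> centralizer N p"
    unfolding generated_semigroup_def
    by (intro hull_minimal map_semigroup_centralizer)
  then show "network_symmetry N (generated_semigroup N \<Sigma>) p"
    using assms(3) by (auto simp: network_symmetry_def centralizer_def)
next
  assume "network_symmetry N (generated_semigroup N \<Sigma>) p"
  moreover have "\<Sigma> \<subseteq> generated_semigroup N \<Sigma>"
    unfolding generated_semigroup_def by (rule hull_subset)
  ultimately show "network_symmetry N \<Sigma> p"
    by (auto simp: network_symmetry_def)
qed

end
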